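(* For every graph $G$, $\mathsf{tree}\text{-}\alpha(L(G))\le \mathsf{tw}(G)+1$. Moreover, the bound is sharp: for every integer $n\ge 3$ there exists a graph $G$ such that $\mathsf{tw}(G)=n$ and $\mathsf{tree}\text{-}\alpha(L(G))=n+1$.
   Context: Graphs are finite and simple; $L(G)$ is the line graph of $G$. A tree decomposition of $G$ is a pair $(T,\beta)$ with $T$ a tree and $\beta:V(T)\to 2^{V(G)}$ such that every vertex lies in some bag, every edge has both endpoints in some bag, and for each vertex the nodes whose bags contain it induce a subtree. Its width is $\max_t|\beta(t)|-1$ and $\mathsf{tw}(G)$ is the minimum width; its independence number is $\max_t\alpha(G[\beta(t)])$ and $\mathsf{tree}\text{-}\alpha(G)$ is the minimum independence number over all tree decompositions. *)

theory Defs
  imports "Graph_Theory.Digraph_Component"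
begin

text \<open>
  A finite simple graph is a symmetric loop-free digraph on finitely many vertices (locale
  \<^locale>\<open>pair_graph\<close>), the edge uv being the pair of arcs (u,v), (v,u). The null graph is allowed.
\<close>

text \<open>
  The constant \<^const>\<open>tree\<close> of the library forbids directed cycles only, and in a symmetric digraph
  the walk u, v, u already counts as a \<^const>\<open>pre_digraph.cycle\<close>. It is therefore not the notion of
  an undirected tree. The cycles of a simple graph are the cycles of length at least 3 of the
  corresponding symmetric digraph. Connected graphs (\<^const>\<open>connected\<close>), and so trees, are nonempty.
\<close>
definition undirected_tree :: "('a, 'b) pre_digraph \<Rightarrow> bool" where
  "undirected_tree T \<longleftrightarrow>
     graph T \<and> connected T \<and> \<not> (\<exists>p. pre_digraph.cycle T p \<and> 3 \<le> length p)"

definition line_graph :: "'a pair_pre_digraph \<Rightarrow> 'a set pair_pre_digraph" where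
  "line_graph G =
     (let E = {{u, v} | u v. (u, v) \<in> parcs G}
      in \<lparr> pverts = E, parcs = {(e, f). e \<in> E \<and> f \<in> E \<and> e \<noteq> f \<and> e \<inter> f \<noteq> {}} \<rparr>)"

definition independent_set :: "('a, 'b) pre_digraph \<Rightarrow> 'a set \<Rightarrow> bool" where
  "independent_set G S \<longleftrightarrow> S \<subseteq> verts G \<and> (\<forall>u\<in>S. \<forall>v\<in>S. \<not> u \<rightarrow>\<^bsub>G\<^esub> v)"

definition independence_number :: "('a, 'b) pre_digraph \<Rightarrow> nat" where
  "independence_number G = Max (card ` {S. independent_set G S})"

definition tree_decomposition ::
  "'a pair_pre_digraph \<Rightarrow> 't pair_pre_digraph \<Rightarrow> ('t \<Rightarrow> 'a set) \<Rightarrow> bool" where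
  "tree_decomposition G T \<beta> \<longleftrightarrow>
     undirected_tree (with_proj T) \<and>
     (\<forall>t\<in>pverts T. \<beta> t \<subseteq> pverts G) \<and>
     (\<forall>v\<in>pverts G. \<exists>t\<in>pverts T. v \<in> \<beta> t) \<and>
     (\<forall>(u, v)\<in>parcs G. \<exists>t\<in>pverts T. u \<in> \<beta> t \<and> v \<in> \<beta> t) \<and>
     (\<forall>v\<in>pverts G. undirected_tree (with_proj T \<restriction> {t \<in> pverts T. v \<in> \<beta> t}))"

text \<open>Widths are integers: the null graph has treewidth -1.\<close>
definition decomposition_width :: "'t pair_pre_digraph \<Rightarrow> ('t \<Rightarrow> 'a set) \<Rightarrow> int" where
  "decomposition_width T \<beta> = int (Max ((\<lambda>t. card (\<beta> t)) ` pverts T)) - 1"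

definition decomposition_independence_number ::
  "'a pair_pre_digraph \<Rightarrow> 't pair_pre_digraph \<Rightarrow> ('t \<Rightarrow> 'a set) \<Rightarrow> nat" where
  "decomposition_independence_number G T \<beta> =
     Max ((\<lambda>t. independence_number (with_proj G \<restriction> \<beta> t)) ` pverts T)"

text \<open>
  Both minima range over trees with natural numbers as nodes. This is no restriction, since every
  finite tree is isomorphic to one of these.
\<close>
definition treewidth :: "'a pair_pre_digraph \<Rightarrow> int" where
  "treewidth G =
     (LEAST w. \<exists>(T :: nat pair_pre_digraph) \<beta>.
        tree_decomposition G T \<beta> \<and> w = decomposition_width T \<beta>)"

definition tree_independence_number :: "'a pair_pre_digraph \<Rightarrow> nat" where
  "tree_independence_number G =
     (LEAST k. \<exists>(T :: nat pair_pre_digraph) \<beta>.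
        tree_decomposition G T \<beta> \<and> k = decomposition_independence_number G T \<beta>)"

lemma pair_graph_line_graph:
  assumes "pair_graph G"
  shows "pair_graph (line_graph G)"
proof -
  interpret pair_graph G by fact
  let ?E = "{{u, v} | u v. (u, v) \<in> parcs G}"
  have "?E = (\<lambda>(u, v). {u, v}) ` parcs G" by auto
  then have fin: "finite ?E" using pair_finite_arcs by simp
  have "finite {(e, f). e \<in> ?E \<and> f \<in> ?E \<and> e \<noteq> f \<and> e \<inter> f \<noteq> {}}"
    by (rule finite_subset[OF _ finite_cartesian_product[OF fin fin]]) auto
  with fin show ?thesis
    by unfold_locales (auto simp: line_graph_def Let_def symmetric_def intro!: symI)
qed

lemma undirected_tree_single:
  "undirected_tree (with_proj \<lparr> pverts = {t}, parcs = {} \<rparr>)"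
proof -
  let ?T = "\<lparr> pverts = {t}, parcs = {} \<rparr>"
  interpret pair_graph ?T by unfold_locales (auto simp: symmetric_def sym_def)
  have "graph (with_proj ?T)" by unfold_locales
  moreover have "connected (with_proj ?T)"
    by (auto simp: connected_def strongly_connected_def mk_symmetric_def reachable_def
        intro: rtrancl_on.intros)
  moreover have "\<not> (\<exists>p. cycle p)"
    by (auto simp: cycle_def awalk_def)
  ultimately show ?thesis by (auto simp: undirected_tree_def)
qed

lemma tree_decomposition_trivial:
  assumes "pair_graph G"
  shows "tree_decomposition G \<lparr> pverts = {t}, parcs = {} \<rparr> (\<lambda>_. pverts G)"
proof -
  interpret pair_graph G by fact
  have "with_proj \<lparr> pverts = {t}, parcs = {} \<rparr> \<restriction> {t}
      = with_proj \<lparr> pverts = {t}, parcs = {} \<rparr>"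
    by (simp add: with_proj_def induce_subgraph_def)
  then have "undirected_tree (with_proj \<lparr> pverts = {t}, parcs = {} \<rparr> \<restriction> {t})"
    using undirected_tree_single[of t] by metis
  then show ?thesis
    using undirected_tree_single[of t]
    by (auto simp: tree_decomposition_def dest: in_arcsD1 in_arcsD2)
qed

lemma treewidth_attained:
  assumes "pair_graph G"
  obtains T :: "nat pair_pre_digraph" and \<beta>
  where "tree_decomposition G T \<beta>" "treewidth G = decomposition_width T \<beta>"
    "\<And>(T' :: nat pair_pre_digraph) \<beta>'.
       tree_decomposition G T' \<beta>' \<Longrightarrow> treewidth G \<le> decomposition_width T' \<beta>'"
proof -
  define P where "P w \<longleftrightarrow> (\<exists>(T :: nat pair_pre_digraph) \<beta>.
    tree_decomposition G T \<beta> \<and> w = decomposition_width T \<beta>)" for w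
  define Q where "Q k \<longleftrightarrow> P (int k - 1)" for k
  have PQ: "Q (nat (w + 1)) \<and> 0 \<le> w + 1" if "P w" for w
  proof -
    have "0 \<le> w + 1" using that by (auto simp: P_def decomposition_width_def)
    with that show ?thesis by (simp add: Q_def)
  qed
  have "\<exists>w. P w"
    unfolding P_def using tree_decomposition_trivial[OF assms, of 0] by blast
  then obtain w where "Q (nat (w + 1))" using PQ by blast
  then have Q: "Q (LEAST k. Q k)" by (rule LeastI)
  have least: "int (LEAST k. Q k) - 1 \<le> w" if "P w" for w
  proof -
    have "(LEAST k. Q k) \<le> nat (w + 1)" using PQ[OF that] by (intro Least_le) simp
    with PQ[OF that] show ?thesis by linarith
  qed
  have tw: "treewidth G = int (LEAST k. Q k) - 1"
    unfolding treewidth_def P_def[symmetric]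
    by (rule Least_equality) (use Q least in \<open>auto simp: Q_def\<close>)
  with Q obtain T :: "nat pair_pre_digraph" and \<beta>
    where "tree_decomposition G T \<beta>" "treewidth G = decomposition_width T \<beta>"
    by (auto simp: Q_def P_def)
  moreover have "treewidth G \<le> decomposition_width T' \<beta>'"
    if "tree_decomposition G T' \<beta>'" for T' :: "nat pair_pre_digraph" and \<beta>'
    unfolding tw by (rule least) (use that in \<open>auto simp: P_def\<close>)
  ultimately show thesis by (rule that)
qed

lemma tree_independence_number_attained:
  assumes "pair_graph G"
  obtains T :: "nat pair_pre_digraph" and \<beta>
  where "tree_decomposition G T \<beta>"
    "tree_independence_number G = decomposition_independence_number G T \<beta>"
proof -
  have "\<exists>k (T :: nat pair_pre_digraph) \<beta>.
      tree_decomposition G T \<beta> \<and> k = decomposition_independence_number G T \<beta>"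
    using tree_decomposition_trivial[OF assms, of 0] by blast
  from LeastI_ex[OF this] show thesis
    unfolding tree_independence_number_def[symmetric] using that by blast
qed

end

theory Submission
  imports Defs
begin

text \<open>
  For the bound, replace every bag of a tree decomposition of G by the set of edges meeting it:
  the nodes containing an edge uv are the union of the subtrees of u and v, which intersect, and
  pairwise disjoint edges meeting a bag are at most as many as its vertices.

  For sharpness, put M = n + 1 and take M core vertices and 4M further vertices, each adjacent
  to all but one core vertex, where every core vertex is missed by four of them. A star of bags
  shows that the treewidth is at most n. In a tree decomposition of the line graph, consider for
  each core vertex i and each set Y of at most n vertices the edges at i that avoid Y. They form a
  clique of the line graph, and any two of these cliques share or touch an edge, because two core
  vertices have a common neighbour outside any 2n vertices. By the Helly property of subtrees some
  bag meets all these cliques, so it contains at least M edges at each core vertex, and a matching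
  of size M can be chosen greedily. The bound then forces the treewidth to be at least n.
\<close>

subsection \<open>Subtrees of an undirected tree\<close>

lemma rtrancl_on_induce_subgraph:
  "rtrancl_on A (arcs_ends (G \<restriction> A)) = rtrancl_on A (arcs_ends G)"
proof (intro set_eqI iffI; clarify)
  fix u v
  show "(u, v) \<in> rtrancl_on A (arcs_ends G)" if "(u, v) \<in> rtrancl_on A (arcs_ends (G \<restriction> A))"
    using that by (rule rtrancl_on_mono[rotated 2]) (auto dest: dominates_induce_subgraphD)
  assume "(u, v) \<in> rtrancl_on A (arcs_ends G)"
  then show "(u, v) \<in> rtrancl_on A (arcs_ends (G \<restriction> A))"
  proof induct
    case (step x y)
    then have "(x, y) \<in> arcs_ends (G \<restriction> A)" by (auto simp: arcs_ends_conv)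
    then show ?case using step by (blast intro: converse_rtrancl_on_into_rtrancl_on)
  qed simp
qed

lemma symmetric_induce_subgraph: "symmetric G \<Longrightarrow> symmetric (G \<restriction> A)"
  unfolding symmetric_conv by simp metis

lemma symcl_sym: "sym r \<Longrightarrow> r\<^sup>s = r"
  by (auto simp: symcl_def sym_def)

lemma connected_induce_subgraph_iff:
  assumes "symmetric G"
  shows "connected (G \<restriction> A) \<longleftrightarrow>
    A \<noteq> {} \<and> (\<forall>u\<in>A. \<forall>v\<in>A. (u, v) \<in> rtrancl_on A (arcs_ends G))"
  using symmetric_induce_subgraph[OF assms, of A]
  by (simp add: connected_conv symcl_sym symmetric_def rtrancl_on_induce_subgraph)

text \<open>Any two members share a vertex, through which a path in the first can be continued in
  the second.\<close>

lemma connected_UN_induce_subgraph: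
  assumes "symmetric G" "I \<noteq> {}"
    and conn: "\<And>i. i \<in> I \<Longrightarrow> connected (G \<restriction> A i)"
    and meet: "\<And>i j. i \<in> I \<Longrightarrow> j \<in> I \<Longrightarrow> A i \<inter> A j \<noteq> {}"
  shows "connected (G \<restriction> (\<Union>i\<in>I. A i))"
  unfolding connected_induce_subgraph_iff[OF \<open>symmetric G\<close>]
proof (intro conjI ballI)
  show "(\<Union>i\<in>I. A i) \<noteq> {}" using assms(2) meet by blast
next
  fix u v assume "u \<in> (\<Union>i\<in>I. A i)" "v \<in> (\<Union>i\<in>I. A i)"
  then obtain i j where ij: "i \<in> I" "u \<in> A i" "j \<in> I" "v \<in> A j" by blast
  with meet obtain w where w: "w \<in> A i" "w \<in> A j" by blast
  have "(x, y) \<in> rtrancl_on (\<Union>i\<in>I. A i) (arcs_ends G)" if "k \<in> I" "x \<in> A k" "y \<in> A k" for k x y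
    using conn[OF \<open>k \<in> I\<close>] that connected_induce_subgraph_iff[OF \<open>symmetric G\<close>]
    by (blast intro: rtrancl_on_mono[OF subset_refl])
  with ij w show "(u, v) \<in> rtrancl_on (\<Union>i\<in>I. A i) (arcs_ends G)"
    by (blast intro: rtrancl_on_trans)
qed

lemma graph_induce_subgraph:
  assumes "graph G" "A \<subseteq> verts G"
  shows "graph (G \<restriction> A)"
proof -
  interpret graph G by fact
  show ?thesis
    using finite_subset[OF assms(2)] symmetric_induce_subgraph[OF sym_arcs]
    by unfold_locales (auto dest: no_loops no_multi_arcs)
qed

text \<open>Every cycle of an induced subgraph is a cycle of \<open>T\<close>, so connectivity is
  all that can fail.\<close>

lemma undirected_tree_induce_subgraph_iff:
  assumes "undirected_tree T" "A \<subseteq> verts T"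
  shows "undirected_tree (T \<restriction> A) \<longleftrightarrow> connected (T \<restriction> A)"
proof -
  interpret graph T using assms by (simp add: undirected_tree_def)
  have sub: "subgraph (T \<restriction> A) T" using assms by (intro induced_imp_subgraph induced_induce)
  have "cycle p" if "pre_digraph.cycle (T \<restriction> A) p" for p
  proof -
    have "pre_digraph.awalk_verts (T \<restriction> A) = awalk_verts"
      by (intro ext compatible_awalk_verts compatible_induce_subgraph)
    then show ?thesis
      using that subgraph_awalk_imp_awalk[OF _ sub] unfolding pre_digraph.cycle_def by metis
  qed
  then show ?thesis
    using assms graph_induce_subgraph[OF graph_axioms assms(2)] by (auto simp: undirected_tree_def)
qed

text \<open>Otherwise a path from \<open>s\<close> to \<open>s'\<close> avoiding \<open>t\<close>
  would close up through \<open>t\<close> to a cycle of \<open>T\<close>.\<close>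

lemma undirected_tree_neighbours_separated:
  assumes "undirected_tree T" and arcs: "t \<rightarrow>\<^bsub>T\<^esub> s" "s' \<rightarrow>\<^bsub>T\<^esub> t"
    and reach: "(s, s') \<in> rtrancl_on (verts T - {t}) (arcs_ends T)"
  shows "s = s'"
proof (rule ccontr)
  assume "s \<noteq> s'"
  interpret graph T using assms by (simp add: undirected_tree_def)
  let ?H = "T \<restriction> (verts T - {t})"
  interpret H: wf_digraph ?H by auto
  have sub: "subgraph ?H T" by (intro induced_imp_subgraph induced_induce) auto
  have "s \<rightarrow>\<^sup>*\<^bsub>?H\<^esub> s'"
    using reach by (simp add: reachable_def rtrancl_on_induce_subgraph)
  then obtain p where Hp: "H.apath s p s'" by (auto simp: H.reachable_apath)
  then have p: "awalk s p s'" and dist: "distinct (awalk_verts s p)"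
    using subgraph_apath_imp_apath[OF Hp sub] by (auto simp: apath_def)
  have "set (H.awalk_verts s p) \<subseteq> verts ?H"
    using H.awalkI_apath[OF Hp] by (rule H.awalkE)
  then have t: "t \<notin> set (awalk_verts s p)"
    by (simp add: compatible_awalk_verts[OF compatible_induce_subgraph]) blast
  obtain e e' where e: "e \<in> arcs T" "tail T e = t" "head T e = s"
    and e': "e' \<in> arcs T" "tail T e' = s'" "head T e' = t"
    using arcs by (auto elim!: reachableE)
  have "p \<noteq> []" using p \<open>s \<noteq> s'\<close> by (auto simp: awalk_Nil_iff)
  have walk: "awalk s (p @ [e']) t"
    using awalk_appendI[OF p, of "[e']" t] arc_implies_awalk[OF e'(1)] e' by simp
  then have "awalk t (e # p @ [e']) t"
    using e by (simp only: awalk_Cons_iff)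
  moreover have "awalk_verts s (p @ [e']) = awalk_verts s p @ [t]"
    using awalk_verts_append[OF walk] e' by simp
  ultimately have "cycle (e # p @ [e'])"
    using dist t e by (auto simp: cycle_def)
  \<comment> \<open>Since \<open>s\<close> and \<open>s'\<close> differ, \<open>p\<close> has an
    arc. This excludes the walk back and forth along one edge, which also counts as a
    \<open>cycle\<close> but is allowed in a tree.\<close>
  moreover have "3 \<le> length (e # p @ [e'])" using \<open>p \<noteq> []\<close> by (cases p) auto
  ultimately show False using assms(1) unfolding undirected_tree_def by blast
qed

text \<open>Cut the path at its first arrival at \<open>t\<close>; the segment before that arrival
  avoids \<open>t\<close>.\<close>

lemma rtrancl_on_last_step:
  assumes "(b, t) \<in> rtrancl_on S r" "b \<noteq> t"
  shows "\<exists>s. (b, s) \<in> rtrancl_on (S - {t}) r \<and> (s, t) \<in> r"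
proof -
  let ?Q = "\<exists>s. (b, s) \<in> rtrancl_on (S - {t}) r \<and> (s, t) \<in> r"
  have "(b, y) \<in> rtrancl_on (S - {t}) r \<or> ?Q" if "(b, y) \<in> rtrancl_on S r" for y
    using that
  proof (induct rule: rtrancl_on_induct)
    case base
    then show ?case using \<open>b \<noteq> t\<close> by simp
  next
    case (step y z)
    then show ?case by (cases "z = t") (auto intro: rtrancl_on_into_rtrancl_on)
  qed
  from this[OF assms(1)] show ?thesis by (auto dest: in_rtrancl_on_in_F)
qed

text \<open>
  If the family had no common node, choose a node t and a member avoiding it such that the
  component of T - t containing this member is smallest. Moving from t to its neighbour s in that
  component, the member that avoids s lies in a strictly smaller component of T - s.
\<close>
lemma undirected_tree_Helly:
  assumes tree: "undirected_tree T"
    and conn: "\<And>A. A \<in> \<F> \<Longrightarrow> A \<subseteq> verts T \<and> connected (T \<restriction> A)"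
    and meet: "\<And>A B. A \<in> \<F> \<Longrightarrow> B \<in> \<F> \<Longrightarrow> A \<inter> B \<noteq> {}"
  shows "\<exists>t\<in>verts T. \<forall>A\<in>\<F>. t \<in> A"
proof (rule ccontr)
  assume "\<not> ?thesis"
  then have miss: "\<exists>A\<in>\<F>. t \<notin> A" if "t \<in> verts T" for t using that by blast
  interpret graph T using tree by (simp add: undirected_tree_def)
  let ?r = "arcs_ends T"
  \<comment> \<open>For a node \<open>a\<close> other than \<open>t\<close>, this is the component
    of T - t containing \<open>a\<close>.\<close>
  define C where "C t a = {y. (a, y) \<in> rtrancl_on (verts T - {t}) ?r}" for t a
  have C_sub: "C t a \<subseteq> verts T - {t}" for t a
    by (auto simp: C_def dest: in_rtrancl_on_in_F)
  have symC: "sym (rtrancl_on S ?r)" for S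
    using sym_arcs by (auto simp: symmetric_def intro: rtrancl_on_sym)
  have C_eq: "C t a = C t b" if "b \<in> C t a" for t a b
    using that symD[OF symC] by (auto simp: C_def intro: rtrancl_on_trans)
  have mem_C: "A \<subseteq> C t a" if "A \<in> \<F>" "t \<notin> A" "a \<in> A" for A t a
  proof
    fix y assume "y \<in> A"
    then have "(a, y) \<in> rtrancl_on A ?r"
      using that conn[OF that(1)] by (simp add: connected_induce_subgraph_iff[OF sym_arcs])
    moreover have "A \<subseteq> verts T - {t}" using conn[OF that(1)] that by blast
    ultimately show "y \<in> C t a" unfolding C_def by (blast intro: rtrancl_on_mono[OF subset_refl])
  qed
  \<comment> \<open>The triples over which \<open>card (C t a)\<close> is minimised;
    \<open>a\<close> merely marks which component contains \<open>A\<close>.\<close>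
  define P where "P = (\<lambda>(t, A, a). t \<in> verts T \<and> A \<in> \<F> \<and> t \<notin> A \<and> a \<in> A)"
  have ex: "\<exists>A a. P (t, A, a)" if t: "t \<in> verts T" for t
  proof -
    from miss[OF t] obtain A where "A \<in> \<F>" "t \<notin> A" by blast
    \<comment> \<open>A member meets itself, hence is nonempty and supplies
      \<open>a\<close>.\<close>
    with meet[of A A] t show ?thesis unfolding P_def by blast
  qed
  from tree have "verts T \<noteq> {}" by (simp add: undirected_tree_def connected_conv)
  with ex have "\<exists>z. P z" by blast
  then obtain z where "P z" and least_z: "\<And>z'. P z' \<Longrightarrow>
      card (C (fst z) (snd (snd z))) \<le> card (C (fst z') (snd (snd z')))"
    using ex_has_least_nat[of P _ "\<lambda>z. card (C (fst z) (snd (snd z)))"] by blast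
  obtain t A a where z: "z = (t, A, a)" by (cases z)
  with \<open>P z\<close> have t: "t \<in> verts T" and A: "A \<in> \<F>" "t \<notin> A" "a \<in> A" by (auto simp: P_def)
  have least: "card (C t a) \<le> card (C t' a')" if "P (t', A', a')" for t' A' a'
    using least_z[OF that] z by simp
  have a: "a \<in> verts T" "a \<noteq> t" using A conn by blast+
  have "(a, t) \<in> rtrancl_on (verts T) ?r"
    using tree a t sym_arcs
    by (simp add: undirected_tree_def connected_conv symcl_sym symmetric_def)
  from rtrancl_on_last_step[OF this \<open>a \<noteq> t\<close>] obtain s where s: "s \<in> C t a" "s \<rightarrow>\<^bsub>T\<^esub> t" by (auto simp: C_def)
  have "s \<in> verts T" using s(2) by (rule adj_in_verts)
  then obtain B where B: "B \<in> \<F>" "s \<notin> B" using miss by blast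
  with meet A obtain b where b: "b \<in> A" "b \<in> B" by blast
  have bC: "b \<in> C t a" using mem_C A b by blast
  have "b \<noteq> s" using B b by auto
  have Pb: "P (s, B, b)" using \<open>s \<in> verts T\<close> B b by (auto simp: P_def)
  show False
  proof (cases "t \<in> C s b")
    case True
    \<comment> \<open>A path from \<open>b\<close> to \<open>t\<close> avoiding \<open>s\<close>
      would enter \<open>t\<close> from a neighbour \<open>s'\<close> in the same component of T - t
      as \<open>s\<close>. Then \<open>s'\<close> is \<open>s\<close>, which the path
      avoids.\<close>
    then obtain s' where s': "(b, s') \<in> rtrancl_on (verts T - {s} - {t}) ?r" "s' \<rightarrow>\<^bsub>T\<^esub> t"
      using rtrancl_on_last_step[of b t "verts T - {s}"] A b by (auto simp: C_def)
    then have "(b, s') \<in> rtrancl_on (verts T - {t}) ?r"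
      by (auto intro: rtrancl_on_mono[of ?r ?r "verts T - {s} - {t}"])
    then have "(s, s') \<in> rtrancl_on (verts T - {t}) ?r"
      using C_eq[OF s(1)] bC by (auto simp: C_def intro: rtrancl_on_trans symD[OF symC])
    then have "s = s'"
      using undirected_tree_neighbours_separated[OF tree _ s'(2)] s(2) sym_arcs
      by (auto dest: arcs_ends_symmetric)
    with s'(1) show False by (auto dest: in_rtrancl_on_in_F)
  next
    case False
    have "C s b \<subseteq> C t b"
    proof
      fix y assume "y \<in> C s b"
      then have "(b, y) \<in> rtrancl_on (verts T - {s}) ?r" by (simp add: C_def)
      \<comment> \<open>The first conjunct is carried along because it shows that the next node lies
        in \<open>C s b\<close> and so differs from \<open>t\<close>.\<close>
      then have "(b, y) \<in> rtrancl_on (verts T - {s}) ?r \<and> y \<in> C t b"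
      proof (induct rule: rtrancl_on_induct)
        case base
        then show ?case using b A C_sub[of t a] bC by (auto simp: C_def)
      next
        case (step y z)
        then have "(b, z) \<in> rtrancl_on (verts T - {s}) ?r" by (auto intro: rtrancl_on_into_rtrancl_on)
        with False have "z \<noteq> t" by (auto simp: C_def)
        with step \<open>(b, z) \<in> _\<close> show ?case by (auto simp: C_def intro: rtrancl_on_into_rtrancl_on)
      qed
      then show "y \<in> C t b" ..
    qed
    \<comment> \<open>The node \<open>s\<close> itself makes the inclusion strict.\<close>
    moreover have "s \<in> C t b" "s \<notin> C s b" using s(1) C_eq[OF bC] C_sub by auto
    ultimately have "C s b \<subset> C t a" using C_eq[OF bC] by blast
    moreover have "finite (C t a)" using C_sub finite_verts by (blast intro: finite_subset)
    ultimately have "card (C s b) < card (C t a)" by (rule psubset_card_mono[rotated])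
    with least[OF Pb] show False by simp
  qed
qed

text \<open>Arcs of a walk alternately enter and leave \<open>c\<close>, so no closed walk has three
  arcs. Among four consecutive arcs two have head \<open>c\<close>, which the distinct vertices of a
  cycle forbid.\<close>

lemma undirected_tree_star:
  assumes "finite A" "c \<notin> A"
  shows "undirected_tree (with_proj \<lparr>pverts = insert c A, parcs = {c} \<times> A \<union> A \<times> {c}\<rparr>)"
    (is "undirected_tree (with_proj ?S)")
proof -
  interpret pair_graph ?S
    using assms by unfold_locales (auto simp: symmetric_def sym_def)
  have "(u, v) \<in> rtrancl_on (insert c A) (parcs ?S)" if "u \<in> insert c A" "v \<in> insert c A" for u v
  proof -
    have "(u, c) \<in> rtrancl_on (insert c A) (parcs ?S)" "(c, v) \<in> rtrancl_on (insert c A) (parcs ?S)"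
      using that by (auto intro: rtrancl_on_into_rtrancl_on[OF rtrancl_on_refl])
    then show ?thesis by (rule rtrancl_on_trans)
  qed
  moreover have "sym (parcs ?S)" by (auto simp: sym_def)
  ultimately have "connected (with_proj ?S)" by (simp add: connected_conv symcl_sym)
  moreover have "\<not> 3 \<le> length p" if "cycle p" for p
  proof
    assume "3 \<le> length p"
    then obtain e f g q where p: "p = e # f # g # q"
      by (metis One_nat_def Suc_le_length_iff numeral_3_eq_3)
    from that obtain u where u: "awalk u p u" and dist: "distinct (tl (awalk_verts u p))"
      by (auto simp: cycle_def)
    have cas: "pcas u p u" using u by (rule awalkE)
    have arcs: "set p \<subseteq> parcs ?S" using u by (rule awalkE)
    have "awalk_verts u p = fst e # map snd p"
      using awalk_verts_conv'[OF cas] by (simp add: p)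
    with dist have snd: "distinct (map snd p)" by simp
    have alt: "fst x = c \<longleftrightarrow> snd x \<noteq> c" if "x \<in> set p" for x
      using that arcs assms(2) by auto
    have ends: "fst f = snd e" "fst g = snd f" using cas by (simp_all add: p)
    show False
    proof (cases q)
      case Nil
      then have "snd g = fst e" using cas by (simp add: p)
      then show False using alt[of e] alt[of f] alt[of g] ends by (simp add: p)
    next
      case (Cons h r)
      then have "fst h = snd g" using cas by (simp add: p)
      moreover have "snd e \<noteq> snd g" "snd f \<noteq> snd h" using snd by (simp_all add: p Cons)
      ultimately show False
        using alt[of e] alt[of f] alt[of g] alt[of h] ends by (auto simp: p Cons)
    qed
  qed
  moreover have "graph (with_proj ?S)" by unfold_locales
  ultimately show ?thesis unfolding undirected_tree_def by blast
qed

subsection \<open>Line graphs\<close>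

lemma finite_independent_sets:
  assumes "finite (verts G)"
  shows "finite {S. independent_set G S}"
  by (rule finite_subset[of _ "Pow (verts G)"]) (use assms in \<open>auto simp: independent_set_def\<close>)

lemma independence_number_le:
  assumes "finite (verts G)" "\<And>S. independent_set G S \<Longrightarrow> card S \<le> k"
  shows "independence_number G \<le> k"
proof -
  \<comment> \<open>This keeps the \<open>Max\<close> from ranging over an empty set.\<close>
  have "independent_set G {}" by (simp add: independent_set_def)
  then have "card ` {S. independent_set G S} \<noteq> {}" by blast
  with finite_imageI[OF finite_independent_sets[OF assms(1)]] show ?thesis
    unfolding independence_number_def by (rule Max.boundedI) (use assms(2) in blast)
qed

lemma card_le_independence_number:
  assumes "finite (verts G)" "independent_set G S"
  shows "card S \<le> independence_number G"
  unfolding independence_number_def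
  using finite_independent_sets[OF assms(1)] assms(2) by (intro Max_ge) auto

lemma tree_decompositionD:
  assumes "tree_decomposition G T \<beta>"
  shows "undirected_tree (with_proj T)" "finite (pverts T)" "pverts T \<noteq> {}"
    "symmetric (with_proj T)"
    and "\<And>t. t \<in> pverts T \<Longrightarrow> \<beta> t \<subseteq> pverts G"
    and "\<And>u v. (u, v) \<in> parcs G \<Longrightarrow> \<exists>t\<in>pverts T. u \<in> \<beta> t \<and> v \<in> \<beta> t"
    and "\<And>v. v \<in> pverts G \<Longrightarrow> connected (with_proj T \<restriction> {t \<in> pverts T. v \<in> \<beta> t})"
proof -
  show tree: "undirected_tree (with_proj T)" using assms by (simp add: tree_decomposition_def)
  interpret graph "with_proj T" using tree by (simp add: undirected_tree_def)
  show "finite (pverts T)" using finite_verts by simp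
  show "symmetric (with_proj T)" by (rule sym_arcs)
  show "pverts T \<noteq> {}" using tree by (simp add: undirected_tree_def connected_conv)
  show "\<beta> t \<subseteq> pverts G" if "t \<in> pverts T" for t
    using assms that by (simp add: tree_decomposition_def)
  show "\<exists>t\<in>pverts T. u \<in> \<beta> t \<and> v \<in> \<beta> t" if "(u, v) \<in> parcs G" for u v
  proof -
    have "\<forall>(u, v)\<in>parcs G. \<exists>t\<in>pverts T. u \<in> \<beta> t \<and> v \<in> \<beta> t"
      using assms by (simp add: tree_decomposition_def)
    from bspec[OF this that] show ?thesis by simp
  qed
  show "connected (with_proj T \<restriction> {t \<in> pverts T. v \<in> \<beta> t})" if "v \<in> pverts G" for v
    using assms that by (simp add: tree_decomposition_def undirected_tree_def)
qed

lemma line_graph_simps: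
  "pverts (line_graph G) = {{u, v} | u v. (u, v) \<in> parcs G}"
  "parcs (line_graph G) = {(e, f). e \<in> pverts (line_graph G) \<and> f \<in> pverts (line_graph G) \<and>
     e \<noteq> f \<and> e \<inter> f \<noteq> {}}"
  by (simp_all add: line_graph_def Let_def)

text \<open>The subtrees of the two ends of an edge share a node because some bag contains both
  ends, so their union is connected. Edges with a common end \<open>v\<close> lie together at any
  node whose bag contains \<open>v\<close>.\<close>

lemma tree_decomposition_line_graph:
  assumes "pair_graph G" and td: "tree_decomposition G T \<beta>"
  shows "tree_decomposition (line_graph G) T (\<lambda>t. {e \<in> pverts (line_graph G). e \<inter> \<beta> t \<noteq> {}})"
    (is "tree_decomposition ?L T ?\<gamma>")
proof -
  interpret pair_graph G by fact
  note td = td tree_decompositionD[OF td]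
  have node: "\<exists>t\<in>pverts T. v \<in> \<beta> t" if "v \<in> pverts G" for v
    using td(1) that by (auto simp: tree_decomposition_def)
  have sub: "v \<in> pverts G" if "e \<in> pverts ?L" "v \<in> e" for e v
    using that by (auto simp: line_graph_simps dest: in_arcsD1 in_arcsD2)
  have subtree: "undirected_tree (with_proj T \<restriction> {t \<in> pverts T. e \<in> ?\<gamma> t})" if e: "e \<in> pverts ?L" for e
  proof -
    obtain u v where uv: "e = {u, v}" "(u, v) \<in> parcs G" using e by (auto simp: line_graph_simps)
    have "{t \<in> pverts T. e \<in> ?\<gamma> t} = (\<Union>w\<in>e. {t \<in> pverts T. w \<in> \<beta> t})" using e by auto
    moreover have "connected (with_proj T \<restriction> (\<Union>w\<in>e. {t \<in> pverts T. w \<in> \<beta> t}))"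
    proof (rule connected_UN_induce_subgraph)
      show "connected (with_proj T \<restriction> {t \<in> pverts T. w \<in> \<beta> t})" if "w \<in> e" for w
        using td(8) sub[OF e that] by blast
      show "{t \<in> pverts T. w \<in> \<beta> t} \<inter> {t \<in> pverts T. w' \<in> \<beta> t} \<noteq> {}"
        if "w \<in> e" "w' \<in> e" for w w'
        using that td(7)[OF uv(2)] uv(1) by blast
    qed (use td(5) uv in auto)
    ultimately show ?thesis
      using undirected_tree_induce_subgraph_iff[OF td(2), of "{t \<in> pverts T. e \<in> ?\<gamma> t}"] by auto
  qed
  have common: "\<exists>t\<in>pverts T. e \<in> ?\<gamma> t \<and> f \<in> ?\<gamma> t"
    if "e \<in> pverts ?L" "f \<in> pverts ?L" "e \<inter> f \<noteq> {}" for e f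
  proof -
    from that(3) obtain v where v: "v \<in> e" "v \<in> f" by blast
    with node sub that(1) obtain t where "t \<in> pverts T" "v \<in> \<beta> t" by blast
    with v that show ?thesis by blast
  qed
  have ne: "e \<inter> e \<noteq> {}" if "e \<in> pverts ?L" for e using that by (auto simp: line_graph_simps)
  show ?thesis
    unfolding tree_decomposition_def
  proof (intro conjI ballI)
    show "\<exists>t\<in>pverts T. e \<in> ?\<gamma> t" if "e \<in> pverts ?L" for e
      using common[OF that that ne[OF that]] by blast
    show "case z of (e, f) \<Rightarrow> \<exists>t\<in>pverts T. e \<in> ?\<gamma> t \<and> f \<in> ?\<gamma> t" if "z \<in> parcs ?L" for z
      using that common unfolding line_graph_simps(2) by (cases z) simp
    show "undirected_tree (with_proj T \<restriction> {t \<in> pverts T. e \<in> ?\<gamma> t})" if "e \<in> pverts ?L" for e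
      using that by (rule subtree)
  qed (use td(2) in blast)+
qed

lemma tree_independence_number_line_graph_le:
  assumes "pair_graph G"
  shows "int (tree_independence_number (line_graph G)) \<le> treewidth G + 1"
proof -
  interpret pair_graph G by fact
  interpret L: pair_graph "line_graph G" by (rule pair_graph_line_graph[OF assms])
  obtain T :: "nat pair_pre_digraph" and \<beta> where td: "tree_decomposition G T \<beta>"
    and tw: "treewidth G = decomposition_width T \<beta>"
    using treewidth_attained[OF assms] by metis
  define \<gamma> where "\<gamma> t = {e \<in> pverts (line_graph G). e \<inter> \<beta> t \<noteq> {}}" for t
  have T: "finite (pverts T)" "pverts T \<noteq> {}" using tree_decompositionD[OF td] by auto
  have "independence_number (with_proj (line_graph G) \<restriction> \<gamma> t) \<le> card (\<beta> t)" if t: "t \<in> pverts T" for t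
  proof (rule independence_number_le)
    have "finite (\<beta> t)"
      using tree_decompositionD(5)[OF td t] pair_finite_verts by (rule finite_subset)
    show "finite (verts (with_proj (line_graph G) \<restriction> \<gamma> t))"
      using L.pair_finite_verts by (simp add: \<gamma>_def)
    fix S assume "independent_set (with_proj (line_graph G) \<restriction> \<gamma> t) S"
    then have S: "S \<subseteq> \<gamma> t"
      and ind: "\<And>e f. e \<in> S \<Longrightarrow> f \<in> S \<Longrightarrow> \<not> (e, f) \<in> arcs_ends (with_proj (line_graph G) \<restriction> \<gamma> t)"
      by (auto simp: independent_set_def)
    have disj: "e = f" if "e \<in> S" "f \<in> S" "e \<inter> f \<noteq> {}" for e f
    proof (rule ccontr)
      assume "e \<noteq> f"
      with that S have "(e, f) \<in> parcs (line_graph G)" "e \<in> \<gamma> t" "f \<in> \<gamma> t"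
        by (auto simp: line_graph_simps(2) \<gamma>_def)
      then have "(e, f) \<in> arcs_ends (with_proj (line_graph G) \<restriction> \<gamma> t)"
        by (force simp: arcs_ends_conv)
      with ind that show False by blast
    qed
    have "\<forall>e\<in>S. \<exists>v. v \<in> e \<inter> \<beta> t" using S by (auto simp: \<gamma>_def)
    \<comment> \<open>\<open>h\<close> sends each edge of \<open>S\<close> to one of its ends in the
      bag. It is injective because the edges in \<open>S\<close> are pairwise disjoint.\<close>
    then obtain h where h: "\<And>e. e \<in> S \<Longrightarrow> h e \<in> e \<inter> \<beta> t" by metis
    have "inj_on h S" using h disj by (intro inj_onI) (metis IntD1 disjoint_iff)
    moreover have "h ` S \<subseteq> \<beta> t" using h by blast
    ultimately show "card S \<le> card (\<beta> t)" using \<open>finite (\<beta> t)\<close> by (rule card_inj_on_le)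
  qed
  then have "decomposition_independence_number (line_graph G) T \<gamma> \<le> Max ((\<lambda>t. card (\<beta> t)) ` pverts T)"
    unfolding decomposition_independence_number_def using T
    by (intro Max.boundedI) (auto intro: order_trans[OF _ Max_ge])
  moreover have "tree_decomposition (line_graph G) T \<gamma>"
    unfolding \<gamma>_def by (rule tree_decomposition_line_graph[OF assms td])
  then have "tree_independence_number (line_graph G) \<le> decomposition_independence_number (line_graph G) T \<gamma>"
    unfolding tree_independence_number_def by (intro Least_le) blast
  ultimately show ?thesis unfolding tw decomposition_width_def by linarith
qed

subsection \<open>Graphs attaining the bound\<close>

text \<open>
  Every \<^term>\<open>x\<close> beyond the \<^term>\<open>M\<close> core vertices has type \<^term>\<open>x mod M\<close> and misses only the core
  vertex of its type, so each of the \<^term>\<open>M\<close> types has four members.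
\<close>
definition sharp_arcs :: "nat \<Rightarrow> nat rel" where
  "sharp_arcs M = {(i, x). i < M \<and> M \<le> x \<and> x < 5 * M \<and> x mod M \<noteq> i}"

definition sharp_graph :: "nat \<Rightarrow> nat pair_pre_digraph" where
  "sharp_graph M = \<lparr>pverts = {..<5 * M}, parcs = sharp_arcs M \<union> (sharp_arcs M)\<inverse>\<rparr>"

lemma sharp_arcsD:
  assumes "(i, x) \<in> sharp_arcs M"
  shows "i < M" "M \<le> x" "x < 5 * M" "x mod M \<noteq> i" "i \<noteq> x" "i < 5 * M"
  using assms by (auto simp: sharp_arcs_def)

lemma pair_graph_sharp_graph: "pair_graph (sharp_graph M)"
proof -
  have "finite (sharp_arcs M)"
    by (rule finite_subset[of _ "{..<5 * M} \<times> {..<5 * M}"]) (auto dest: sharp_arcsD)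
  then show ?thesis
    by unfold_locales (auto simp: sharp_graph_def symmetric_def sym_def dest: sharp_arcsD)
qed

text \<open>The centre of the star carries the core, and the leaf of a further vertex carries that
  vertex with its \<open>M - 1\<close> neighbours, so every bag has \<open>M\<close>
  elements.\<close>

lemma treewidth_sharp_graph_le:
  assumes "0 < M"
  shows "treewidth (sharp_graph M) \<le> int M - 1"
proof -
  define X where "X = {M..<5 * M}"
  \<comment> \<open>Further vertices name their own leaves. The number 0 is a core vertex, hence
    free to name the centre.\<close>
  define star where "star A = \<lparr>pverts = insert 0 A, parcs = {0} \<times> A \<union> A \<times> {0}\<rparr>" for A :: "nat set"
  define \<beta> where "\<beta> t = (if t = 0 then {..<M} else insert t ({..<M} - {t mod M}))" for t
  have X: "finite X" "0 \<notin> X" using assms by (auto simp: X_def)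
  have tree: "undirected_tree (with_proj (star A))" if "A \<subseteq> X" for A
    unfolding star_def using that X by (intro undirected_tree_star) (auto intro: finite_subset)
  \<comment> \<open>The nodes whose bags contain a given core vertex form a smaller star with the
    same centre.\<close>
  have induce: "with_proj (star X) \<restriction> insert 0 A = with_proj (star A)" if "A \<subseteq> X" for A
    using that X by (auto simp: star_def with_proj_def induce_subgraph_def)
  have "tree_decomposition (sharp_graph M) (star X) \<beta>"
    unfolding tree_decomposition_def
  proof (intro conjI ballI)
    show "undirected_tree (with_proj (star X))" by (rule tree) simp
    show "\<beta> t \<subseteq> pverts (sharp_graph M)" if "t \<in> pverts (star X)" for t
      using that by (auto simp: \<beta>_def star_def sharp_graph_def X_def)
    show "\<exists>t\<in>pverts (star X). v \<in> \<beta> t" if "v \<in> pverts (sharp_graph M)" for v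
      using that by (cases "v < M") (auto simp: \<beta>_def star_def sharp_graph_def X_def)
    show "case z of (u, v) \<Rightarrow> \<exists>t\<in>pverts (star X). u \<in> \<beta> t \<and> v \<in> \<beta> t"
      if z: "z \<in> parcs (sharp_graph M)" for z
    proof -
      have bag: "x \<in> pverts (star X) \<and> i \<in> \<beta> x \<and> x \<in> \<beta> x" if "(i, x) \<in> sharp_arcs M" for i x
        using sharp_arcsD[OF that] assms by (auto simp: \<beta>_def star_def X_def)
      obtain u v where "z = (u, v)" by (cases z)
      with z consider "(u, v) \<in> sharp_arcs M" | "(v, u) \<in> sharp_arcs M" by (auto simp: sharp_graph_def)
      then show ?thesis using bag \<open>z = (u, v)\<close> by cases auto
    qed
    show "undirected_tree (with_proj (star X) \<restriction> {t \<in> pverts (star X). v \<in> \<beta> t})"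
      if v: "v \<in> pverts (sharp_graph M)" for v
    proof (cases "v < M")
      case True
      then have "{t \<in> pverts (star X). v \<in> \<beta> t} = insert 0 {t \<in> X. t mod M \<noteq> v}"
        by (auto simp: \<beta>_def star_def X_def)
      then show ?thesis using induce[of "{t \<in> X. t mod M \<noteq> v}"] tree[of "{t \<in> X. t mod M \<noteq> v}"] by simp
    next
      case False
      then have "{t \<in> pverts (star X). v \<in> \<beta> t} = {v}"
        using v by (auto simp: \<beta>_def star_def X_def sharp_graph_def)
      moreover have "v \<noteq> 0" using False assms by simp
      then have "with_proj (star X) \<restriction> {v} = with_proj \<lparr>pverts = {v}, parcs = {}\<rparr>"
        by (auto simp: star_def with_proj_def induce_subgraph_def)
      ultimately show ?thesis using undirected_tree_single[of v] by simp
    qed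
  qed
  then have "treewidth (sharp_graph M) \<le> decomposition_width (star X) \<beta>"
    using treewidth_attained[OF pair_graph_sharp_graph, of M] by metis
  also have "decomposition_width (star X) \<beta> \<le> int M - 1"
  proof -
    have "card (\<beta> t) \<le> M" if "t \<in> pverts (star X)" for t
    proof (cases "t = 0")
      case False
      then have "M \<le> t" "t mod M < M" using that assms by (auto simp: star_def X_def)
      then have "card (\<beta> t) = Suc (M - 1)" using False by (simp add: \<beta>_def card_Diff_singleton)
      then show ?thesis using assms by simp
    qed (simp add: \<beta>_def)
    then have "Max ((\<lambda>t. card (\<beta> t)) ` pverts (star X)) \<le> M"
      using X by (intro Max.boundedI) (auto simp: star_def)
    then show ?thesis by (simp add: decomposition_width_def)
  qed
  finally show ?thesis .
qed

text \<open>A further vertex fails to be a common neighbour only if its type is \<open>i\<close> or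
  \<open>j\<close>. This excludes at most 8 of the \<open>4 * M\<close> further vertices, and
  \<open>Y\<close> at most \<open>2 * (M - 1)\<close> more.\<close>

lemma common_neighbour_sharp_graph:
  assumes "4 \<le> M" "finite Y" "card Y \<le> 2 * (M - 1)" "i < M" "j < M"
  shows "\<exists>x. (i, x) \<in> sharp_arcs M \<and> (j, x) \<in> sharp_arcs M \<and> x \<notin> Y"
proof -
  \<comment> \<open>For \<open>k < M\<close>, these are the four further vertices of type
    \<open>k\<close>.\<close>
  define R where "R k = (\<lambda>q. q * M + k) ` {1..<5}" for k
  have R: "x \<in> R k" if "M \<le> x" "x < 5 * M" "x mod M = k" for x k
  proof -
    have "x = x div M * M + k" unfolding that(3)[symmetric] by (rule div_mult_mod_eq[symmetric])
    moreover have "x div M < 5" using that by (simp add: less_mult_imp_div_less)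
    moreover have "1 \<le> x div M" using that assms(1) by (simp add: Suc_le_eq div_greater_zero_iff)
    ultimately show ?thesis unfolding R_def by (intro image_eqI[of _ _ "x div M"]) auto
  qed
  have cR: "card (R k) \<le> 4" for k
    unfolding R_def using card_image_le[of "{1..<5::nat}"] by fastforce
  have "card (Y \<union> (R i \<union> R j)) \<le> card Y + (card (R i) + card (R j))"
    by (meson add_left_mono card_Un_le order_trans)
  \<comment> \<open>The count needs \<open>2 * (M - 1) + 8 < 4 * M\<close>, that is
    \<open>M > 3\<close>; this is where \<open>4 \<le> M\<close> enters.\<close>
  also have "\<dots> < card {M..<5 * M}" using assms(1,3) cR[of i] cR[of j] by simp
  finally have "\<not> {M..<5 * M} \<subseteq> Y \<union> (R i \<union> R j)"
    using card_mono[of "Y \<union> (R i \<union> R j)" "{M..<5 * M}"] assms(2) by (auto simp: R_def)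
  then obtain x where "x \<in> {M..<5 * M}" "x \<notin> Y" "x \<notin> R i" "x \<notin> R j" by blast
  then have "(i, x) \<in> sharp_arcs M \<and> (j, x) \<in> sharp_arcs M \<and> x \<notin> Y"
    using R[of x i] R[of x j] assms(4,5) by (auto simp: sharp_arcs_def)
  then show ?thesis ..
qed

text \<open>Greedy choice: fewer than \<open>M\<close> values have been used before each step, so
  they may serve as \<open>Y\<close>.\<close>

lemma distinct_representatives:
  assumes "\<And>i Y. i < M \<Longrightarrow> finite Y \<Longrightarrow> card Y < M \<Longrightarrow> \<exists>x. P i x \<and> x \<notin> Y"
  shows "\<exists>f. inj_on f {..<M} \<and> (\<forall>i<M. P i (f i))"
proof -
  have "\<exists>f. inj_on f {..<k} \<and> (\<forall>i<k. P i (f i))" if "k \<le> M" for k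
    using that
  proof (induct k)
    case (Suc k)
    then obtain f where f: "inj_on f {..<k}" "\<forall>i<k. P i (f i)" by auto
    have "card (f ` {..<k}) < M" using Suc.prems card_image_le[of "{..<k}" f] by simp
    then obtain x where "P k x" "x \<notin> f ` {..<k}" using assms[of k "f ` {..<k}"] Suc.prems by auto
    with f have "inj_on (f(k := x)) {..<Suc k} \<and> (\<forall>i<Suc k. P i ((f(k := x)) i))"
      by (auto simp: lessThan_Suc less_Suc_eq inj_on_def)
    then show ?case by blast
  qed simp
  then show ?thesis by blast
qed

lemma tree_independence_number_sharp_graph_ge:
  assumes "4 \<le> M"
  shows "M \<le> tree_independence_number (line_graph (sharp_graph M))"
proof -
  let ?L = "line_graph (sharp_graph M)"
  interpret L: pair_graph ?L by (rule pair_graph_line_graph[OF pair_graph_sharp_graph])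
  obtain T :: "nat pair_pre_digraph" and \<beta> where td: "tree_decomposition ?L T \<beta>"
    and tin: "tree_independence_number ?L = decomposition_independence_number ?L T \<beta>"
    using tree_independence_number_attained[OF pair_graph_line_graph[OF pair_graph_sharp_graph]] by metis
  note tdD = tree_decompositionD[OF td]
  define N where "N e = {t \<in> pverts T. e \<in> \<beta> t}" for e
  define D where "D i Y = {{i, x} | x. (i, x) \<in> sharp_arcs M \<and> x \<notin> Y}" for i Y
  \<comment> \<open>A node in all members with first index \<open>i\<close> has a bag in which no
    \<open>Y\<close> with fewer than \<open>M\<close> elements covers the far ends of the edges at
    \<open>i\<close>. Ranging over all \<open>Y\<close> thus encodes that there are at least
    \<open>M\<close> such edges.\<close>
  define \<F> where "\<F> = {\<Union>e\<in>D i Y. N e | i Y. i < M \<and> finite Y \<and> card Y < M}"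
  have edge: "{i, x} \<in> pverts ?L" if "(i, x) \<in> sharp_arcs M" for i x
    using that by (auto simp: line_graph_simps sharp_graph_def)
  have N_ne: "N e \<noteq> {}" and N_conn: "connected (with_proj T \<restriction> N e)" if "e \<in> pverts ?L" for e
    using tdD(7)[OF that] by (auto simp: N_def connected_conv)
  have N_meet: "N e \<inter> N f \<noteq> {}" if "e \<in> pverts ?L" "f \<in> pverts ?L" "e \<inter> f \<noteq> {}" for e f
  proof (cases "e = f")
    case False
    then have "(e, f) \<in> parcs ?L" using that by (simp add: line_graph_simps(2))
    from tdD(6)[OF this] show ?thesis by (auto simp: N_def)
  qed (use N_ne[OF that(1)] in simp)
  have common: "\<exists>x. (i, x) \<in> sharp_arcs M \<and> (j, x) \<in> sharp_arcs M \<and> x \<notin> Y \<and> x \<notin> Z"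
    if "i < M" "j < M" "finite Y" "card Y < M" "finite Z" "card Z < M" for i j Y Z
  proof -
    have "card (Y \<union> Z) \<le> 2 * (M - 1)" using card_Un_le[of Y Z] that by linarith
    with common_neighbour_sharp_graph[OF assms, of "Y \<union> Z" i j] that(1,2,3,5) show ?thesis by simp
  qed
  have "\<exists>t\<in>verts (with_proj T). \<forall>A\<in>\<F>. t \<in> A"
  proof (rule undirected_tree_Helly[OF tdD(1)])
    fix A assume "A \<in> \<F>"
    then obtain i Y where A: "A = (\<Union>e\<in>D i Y. N e)" and iY: "i < M" "finite Y" "card Y < M"
      by (auto simp: \<F>_def)
    have "connected (with_proj T \<restriction> A)"
      unfolding A
    proof (rule connected_UN_induce_subgraph[OF tdD(4)])
      \<comment> \<open>A common neighbour of \<open>i\<close> with itself, outside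
        \<open>Y\<close>, provides an edge.\<close>
      show "D i Y \<noteq> {}" using common[OF iY(1,1,2,3,2,3)] by (auto simp: D_def)
      have D: "e \<in> pverts ?L \<and> i \<in> e" if "e \<in> D i Y" for e using that edge by (auto simp: D_def)
      show "connected (with_proj T \<restriction> N e)" if "e \<in> D i Y" for e using N_conn D[OF that] by blast
      show "N e \<inter> N f \<noteq> {}" if "e \<in> D i Y" "f \<in> D i Y" for e f
        using N_meet D[OF that(1)] D[OF that(2)] by blast
    qed
    moreover have "A \<subseteq> pverts T" by (auto simp: A N_def)
    ultimately show "A \<subseteq> verts (with_proj T) \<and> connected (with_proj T \<restriction> A)" by simp
  next
    fix A B assume "A \<in> \<F>" "B \<in> \<F>"
    then obtain i Y j Z where A: "A = (\<Union>e\<in>D i Y. N e)" and iY: "i < M" "finite Y" "card Y < M"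
      and B: "B = (\<Union>e\<in>D j Z. N e)" and jZ: "j < M" "finite Z" "card Z < M"
      unfolding \<F>_def by blast
    obtain x where x: "(i, x) \<in> sharp_arcs M" "(j, x) \<in> sharp_arcs M" "x \<notin> Y" "x \<notin> Z"
      using common[OF iY(1) jZ(1) iY(2,3) jZ(2,3)] by blast
    \<comment> \<open>The two edges share \<open>x\<close>, so they are equal or adjacent in the
      line graph and occur in a common bag.\<close>
    have "N {i, x} \<inter> N {j, x} \<noteq> {}" using N_meet edge x by blast
    moreover have "{i, x} \<in> D i Y" "{j, x} \<in> D j Z" using x by (auto simp: D_def)
    ultimately show "A \<inter> B \<noteq> {}" unfolding A B by blast
  qed
  then obtain t where t: "t \<in> pverts T" and hit: "\<And>A. A \<in> \<F> \<Longrightarrow> t \<in> A" by auto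
  have "\<exists>x. ((i, x) \<in> sharp_arcs M \<and> {i, x} \<in> \<beta> t) \<and> x \<notin> Y"
    if "i < M" "finite Y" "card Y < M" for i Y
  proof -
    have "(\<Union>e\<in>D i Y. N e) \<in> \<F>" using that by (auto simp: \<F>_def)
    from hit[OF this] show ?thesis by (auto simp: D_def N_def)
  qed
  from distinct_representatives[of M "\<lambda>i x. (i, x) \<in> sharp_arcs M \<and> {i, x} \<in> \<beta> t", OF this]
  obtain f where inj: "inj_on f {..<M}"
    and f: "\<And>i. i < M \<Longrightarrow> (i, f i) \<in> sharp_arcs M \<and> {i, f i} \<in> \<beta> t" by blast
  define S where "S = (\<lambda>i. {i, f i}) ` {..<M}"
  have disj: "i = j" if "i < M" "j < M" "{i, f i} \<inter> {j, f j} \<noteq> {}" for i j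
  proof -
    \<comment> \<open>Core indices lie below \<open>M\<close> and the chosen neighbours do not, so
      overlapping edges share either their core ends or their chosen neighbours.\<close>
    have "i < M" "M \<le> f i" "j < M" "M \<le> f j" using f that sharp_arcsD by blast+
    then have "i = j \<or> f i = f j" using that(3) by auto
    then show ?thesis using inj that by (auto dest: inj_onD)
  qed
  have "card S = M" unfolding S_def
    by (subst card_image) (use disj in \<open>auto intro!: inj_onI\<close>)
  moreover have "independent_set (with_proj ?L \<restriction> \<beta> t) S"
    unfolding independent_set_def
  proof (intro conjI ballI notI)
    show "S \<subseteq> verts (with_proj ?L \<restriction> \<beta> t)" using f by (auto simp: S_def)
    fix e g assume "e \<in> S" "g \<in> S" "e \<rightarrow>\<^bsub>with_proj ?L \<restriction> \<beta> t\<^esub> g"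
    then have "(e, g) \<in> parcs ?L" by (auto dest: dominates_induce_subgraphD)
    then have "e \<noteq> g" "e \<inter> g \<noteq> {}" by (simp_all add: line_graph_simps(2))
    obtain i j where ij: "i < M" "j < M" "e = {i, f i}" "g = {j, f j}"
      using \<open>e \<in> S\<close> \<open>g \<in> S\<close> unfolding S_def by blast
    have "i = j" using \<open>e \<inter> g \<noteq> {}\<close> unfolding ij(3,4) by (rule disj[OF ij(1,2)])
    then have "e = g" unfolding ij(3,4) by (rule arg_cong)
    with \<open>e \<noteq> g\<close> show False ..
  qed
  moreover have "finite (\<beta> t)" using tdD(5)[OF t] L.pair_finite_verts by (rule finite_subset)
  ultimately have "M \<le> independence_number (with_proj ?L \<restriction> \<beta> t)"
    using card_le_independence_number[of "with_proj ?L \<restriction> \<beta> t" S] by simp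
  also have "\<dots> \<le> tree_independence_number ?L"
    unfolding tin decomposition_independence_number_def using t tdD(2) by (intro Max_ge) auto
  finally show ?thesis .
qed

theorem theorem5p3:
  shows "(\<forall>G :: 'a pair_pre_digraph. pair_graph G \<longrightarrow>
            int (tree_independence_number (line_graph G)) \<le> treewidth G + 1) \<and>
         (\<forall>n :: int. 3 \<le> n \<longrightarrow>
            (\<exists>G :: nat pair_pre_digraph. pair_graph G \<and>
               treewidth G = n \<and> int (tree_independence_number (line_graph G)) = n + 1))"
proof (intro conjI allI impI)
  show "int (tree_independence_number (line_graph G)) \<le> treewidth G + 1"
    if "pair_graph G" for G :: "'a pair_pre_digraph"
    using that by (rule tree_independence_number_line_graph_le)
next
  fix n :: int assume "3 \<le> n"
  \<comment> \<open>With \<open>M\<close> equal to \<open>n + 1\<close>, the condition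
    \<open>4 \<le> M\<close> is exactly \<open>3 \<le> n\<close>.\<close>
  then have M: "4 \<le> nat (n + 1)" "int (nat (n + 1)) = n + 1" by simp_all
  let ?G = "sharp_graph (nat (n + 1))"
  have "treewidth ?G \<le> n" using treewidth_sharp_graph_le[of "nat (n + 1)"] M by simp
  moreover have "int (tree_independence_number (line_graph ?G)) \<le> treewidth ?G + 1"
    by (rule tree_independence_number_line_graph_le[OF pair_graph_sharp_graph])
  moreover have "n + 1 \<le> int (tree_independence_number (line_graph ?G))"
    using tree_independence_number_sharp_graph_ge[OF M(1)] by linarith
  \<comment> \<open>The three inequalities bound both \<open>n + 1\<close> from above by the
    tree-independence number and the latter by \<open>treewidth ?G + 1\<close>, itself at most
    \<open>n + 1\<close>, so all are equal.\<close>
  ultimately have "treewidth ?G = n \<and> int (tree_independence_number (line_graph ?G)) = n + 1"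
    by linarith
  with pair_graph_sharp_graph show "\<exists>G :: nat pair_pre_digraph. pair_graph G \<and>
      treewidth G = n \<and> int (tree_independence_number (line_graph G)) = n + 1" by blast
qed

end
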